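(* Let $n,k$ be positive integers with $1\le k\le n-1$. The chromatic number of the $(n,k)$-star graph $S_{n,k}$ is $\chi(S_{n,k})=n-k+1$.
   Context: For a positive integer $m$, $[m]=\{1,2,\ldots,m\}$. For positive integers $n,k$ with $k\in[n-1]$, the $(n,k)$-star graph $S_{n,k}$ is the simple undirected graph whose vertices are the $k$-permutations of $[n]$, i.e. the words $p_1p_2\ldots p_k$ with pairwise distinct symbols $p_i\in[n]$. The vertex $p_1p_2\ldots p_k$ is adjacent exactly to (1) the words obtained by exchanging $p_1$ with $p_s$ for some $2\le s\le k$, and (2) the words $xp_2\ldots p_k$ with $x\in[n]\setminus\{p_1,\ldots,p_k\}$. $\chi(G)$ denotes the chromatic number of $G$ (least number of colours in a proper vertex colouring). *)

theory Defs
  imports "Graph_Theory.Pair_Digraph"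
begin

text \<open>
  As usual in Graph_Theory, an undirected simple graph is a symmetric loop-free digraph
  (locale \<^locale>\<open>pair_graph\<close>), each edge being represented by its two orientations.
\<close>

definition proper_colouring :: "'a pair_pre_digraph \<Rightarrow> nat \<Rightarrow> ('a \<Rightarrow> nat) \<Rightarrow> bool" where
  "proper_colouring G c f \<longleftrightarrow>
     f ` pverts G \<subseteq> {1..c} \<and> (\<forall>(u, v) \<in> parcs G. f u \<noteq> f v)"

text \<open>Only meaningful when some finite number of colours suffices; see
  \<open>proper_colouring_exists\<close> for finite graphs.\<close>

definition chromatic_number :: "'a pair_pre_digraph \<Rightarrow> nat" where
  "chromatic_number G = (LEAST c. \<exists>f. proper_colouring G c f)"

definition k_permutations :: "nat \<Rightarrow> nat \<Rightarrow> nat list set" where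
  "k_permutations n k = {p. length p = k \<and> distinct p \<and> set p \<subseteq> {1..n}}"

text \<open>Lists are indexed from 0: the symbol $p_1$ is \<open>p ! 0\<close>, and $p_s$ with
  $2 \le s \le k$ is \<open>p ! (s - 1)\<close>.\<close>

definition star_adjacent :: "nat \<Rightarrow> nat \<Rightarrow> nat list \<Rightarrow> nat list \<Rightarrow> bool" where
  "star_adjacent n k p q \<longleftrightarrow>
     (\<exists>s\<in>{2..k}. q = p[0 := p ! (s - 1), s - 1 := p ! 0]) \<or>
     (\<exists>x\<in>{1..n} - set p. q = p[0 := x])"

definition star_graph :: "nat \<Rightarrow> nat \<Rightarrow> nat list pair_pre_digraph" where
  "star_graph n k =
     \<lparr> pverts = k_permutations n k,
       parcs = {(p, q). p \<in> k_permutations n k \<and> q \<in> k_permutations n k \<and> star_adjacent n k p q} \<rparr>"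

lemma (in pair_graph) proper_colouring_exists:
  "\<exists>f. proper_colouring G (card (pverts G)) f"
proof -
  obtain f where f: "bij_betw f (pverts G) {1..card (pverts G)}"
    using ex_bij_betw_finite_nat[OF pair_finite_verts] finite_same_card_bij[of "pverts G" "{1..card (pverts G)}"]
    by auto
  have "f u \<noteq> f v" if "(u, v) \<in> parcs G" for u v
  proof -
    have "u \<in> pverts G" "v \<in> pverts G" "u \<noteq> v"
      using arc_fst_in_verts[OF that] arc_snd_in_verts[OF that] pair_no_loops[OF that] by auto
    then show ?thesis using f by (auto simp: bij_betw_def inj_on_def)
  qed
  then show ?thesis
    using f unfolding proper_colouring_def by (intro exI[of _ f]) (auto simp: bij_betw_def)
qed

lemma star_adjacent_closed:
  assumes "p \<in> k_permutations n k" "1 \<le> k" "star_adjacent n k p q"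
  shows "q \<in> k_permutations n k"
proof -
  have p: "length p = k" "distinct p" "set p \<subseteq> {1..n}"
    using assms(1) by (auto simp: k_permutations_def)
  from assms(3) consider
      s where "s \<in> {2..k}" "q = p[0 := p ! (s - 1), s - 1 := p ! 0]"
    | x where "x \<in> {1..n} - set p" "q = p[0 := x]"
    unfolding star_adjacent_def by blast
  then show ?thesis
  proof cases
    case 1
    then have "0 < length p" "s - 1 < length p" using p by auto
    then have "distinct q" "set q = set p" "length q = length p"
      using 1(2) p(2) distinct_swap[of 0 p "s - 1"] set_swap[of 0 p "s - 1"] by simp_all
    then show ?thesis using p by (simp add: k_permutations_def)
  next
    case 2
    then show ?thesis using p set_update_subset_insert[of p 0 x]
      by (auto simp: k_permutations_def distinct_list_update)
  qed
qed

lemma star_adjacent_neq: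
  assumes "p \<in> k_permutations n k" "1 \<le> k" "star_adjacent n k p q"
  shows "p \<noteq> q"
proof -
  have p: "length p = k" "distinct p" using assms(1) by (auto simp: k_permutations_def)
  from assms(3) consider
      s where "s \<in> {2..k}" "q = p[0 := p ! (s - 1), s - 1 := p ! 0]"
    | x where "x \<in> {1..n} - set p" "q = p[0 := x]"
    unfolding star_adjacent_def by blast
  then have "q ! 0 \<noteq> p ! 0"
  proof cases
    case 1
    then have s: "0 < length p" "s - 1 < length p" "s - 1 \<noteq> 0" using p by auto
    then have "q ! 0 = p ! (s - 1)" "p ! (s - 1) \<noteq> p ! 0"
      using p(2) 1(2) by (simp_all add: nth_eq_iff_index_eq)
    then show ?thesis by simp
  next
    case 2
    moreover have "p ! 0 \<in> set p" using p assms(2) by (intro nth_mem) simp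
    moreover have "q ! 0 = x" using 2 p assms(2) by (simp add: nth_list_update)
    ultimately show ?thesis by (metis DiffD2)
  qed
  then show ?thesis by auto
qed

lemma star_adjacent_sym:
  assumes "p \<in> k_permutations n k" "1 \<le> k" "star_adjacent n k p q"
  shows "star_adjacent n k q p"
proof -
  have p: "length p = k" "distinct p" "set p \<subseteq> {1..n}"
    using assms(1) by (auto simp: k_permutations_def)
  from assms(3) consider
      s where "s \<in> {2..k}" "q = p[0 := p ! (s - 1), s - 1 := p ! 0]"
    | x where "x \<in> {1..n} - set p" "q = p[0 := x]"
    unfolding star_adjacent_def by blast
  then show ?thesis
  proof cases
    case 1
    then have "0 < length p" "s - 1 < length p" "s - 1 \<noteq> 0" using p by auto
    then have "p = q[0 := q ! (s - 1), s - 1 := q ! 0]"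
      using 1(2) by (intro nth_equalityI) (simp_all add: nth_list_update)
    then show ?thesis using 1(1) unfolding star_adjacent_def by blast
  next
    case 2
    obtain a r where ar: "p = a # r" using p assms(2) by (cases p) auto
    have "p ! 0 \<in> {1..n} - set q" "p = q[0 := p ! 0]" using 2 p ar by auto
    then show ?thesis unfolding star_adjacent_def by blast
  qed
qed

lemma pair_graph_star_graph:
  assumes "1 \<le> k"
  shows "pair_graph (star_graph n k)"
proof -
  have fin: "finite (k_permutations n k)"
    by (rule finite_subset[OF _ finite_lists_length_eq[of "{1..n}" k]])
       (auto simp: k_permutations_def)
  have "finite (parcs (star_graph n k))"
    by (rule finite_subset[OF _ finite_cartesian_product[OF fin fin]]) (auto simp: star_graph_def)
  then show ?thesis
    using fin star_adjacent_neq[OF _ assms] star_adjacent_sym[OF _ assms]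
    by unfold_locales (auto simp: star_graph_def symmetric_def sym_def arcs_ends_def arc_to_ends_def)
qed

end

theory Submission
  imports Defs "HOL-Combinatorics.Transposition"
begin

text \<open>
  The words that share their last $k - 1$ symbols form a clique of size $n - k + 1$, which gives
  the lower bound (\<open>star_graph_colours_ge\<close>).

  For the upper bound, fix $m = n - k \ge 1$ and colour by induction on $k$ with the colours
  $0, \ldots, m$, starting from the complete graph $S_{m+1,1}$.  In the step, let $N$ be the largest
  symbol and shorten a word by removing its last symbol $b$ and writing $b$ in place of $N$,
  should $N$ occur in the rest.  The result is a vertex of the smaller star graph.
  The map is almost a homomorphism: exchanging the first symbol $a$ with the last
  symbol $b$, where neither is $N$, becomes the exchange of $a$ with the entry that
  held $N$, or, when $N$ does not occur, the replacement of $a$ by the unused symbol $b$.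
  Adjacent words have the same image only when exactly one of them ends in $N$, and every edge
  between a word that ends in $N$ and one that does not is of this kind
  (\<open>absorb_last_adjacent\<close>).  Therefore the colour of the image, shifted cyclically by one
  exactly on the words that end in $N$, is a proper colouring; the shift has no fixed colour
  because there are at least two colours.
\<close>

text \<open>When $N$ itself is the last symbol, the transposition is the identity, so that both cases of
  the shortening need only one formula.  As $b$ does not occur in the rest of the word, nothing
  but $N$ is ever renamed.\<close>

definition absorb_last :: "nat \<Rightarrow> nat list \<Rightarrow> nat list" where
  "absorb_last N p = map (transpose N (last p)) (butlast p)"

lemma absorb_last_snoc [simp]: "absorb_last N (u @ [b]) = map (transpose N b) u"
  by (simp add: absorb_last_def)

lemma k_permutations_Suc_cases:
  assumes "p \<in> k_permutations n (Suc k)"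
  obtains u b where "p = u @ [b]" "length u = k" "distinct u" "set u \<subseteq> {1..n}"
    "b \<in> {1..n}" "b \<notin> set u"
  using assms that by (cases p rule: rev_cases) (auto simp: k_permutations_def)

lemma transpose_last_into_smaller:
  assumes "x \<in> {1..Suc n}" "x \<noteq> b" "b \<in> {1..Suc n}"
  shows "transpose (Suc n) b x \<in> {1..n}"
  using assms by (auto simp: transpose_def)

lemma absorb_last_in_k_permutations:
  assumes "p \<in> k_permutations (Suc n) (Suc k)"
  shows "absorb_last (Suc n) p \<in> k_permutations n k"
proof -
  from assms obtain u b where u: "p = u @ [b]" "length u = k" "distinct u"
    "set u \<subseteq> {1..Suc n}" "b \<in> {1..Suc n}" "b \<notin> set u"
    by (rule k_permutations_Suc_cases)
  have "transpose (Suc n) b x \<in> {1..n}" if "x \<in> set u" for x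
    using transpose_last_into_smaller[of x n b] that u by blast
  then show ?thesis
    using u by (auto simp: k_permutations_def distinct_map)
qed

text \<open>Away from the last position, an edge survives the injective renaming of symbols.  The
  exchange $a\,v\,b \leftrightarrow b\,v\,a$ is the interesting case.  If $b = N$, then $a$ replaces the
  $N$ at the front of $N\,v$, so both words shorten to $a\,v$; the case $a = N$ is symmetric.
  Otherwise the images have the heads $a$ and $b$, and where $v$ contains $N$ they carry
  the other one of the two symbols there.\<close>

lemma absorb_last_adjacent:
  assumes p: "p \<in> k_permutations (Suc n) (Suc k)" and k: "1 \<le> k"
    and adj: "star_adjacent (Suc n) (Suc k) p q"
  shows "((last p = Suc n) = (last q = Suc n) \<and>
            star_adjacent n k (absorb_last (Suc n) p) (absorb_last (Suc n) q)) \<or>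
         ((last p = Suc n) \<noteq> (last q = Suc n) \<and>
            absorb_last (Suc n) p = absorb_last (Suc n) q)"
proof -
  from p obtain u b where u: "p = u @ [b]" "length u = k" "distinct u"
    "set u \<subseteq> {1..Suc n}" "b \<in> {1..Suc n}" "b \<notin> set u"
    by (rule k_permutations_Suc_cases)
  obtain a v where v: "u = a # v" using u(2) k by (cases u) auto
  have ab: "a \<noteq> b" "a \<notin> set v" "b \<notin> set v" using u v by auto
  let ?\<rho> = "transpose (Suc n) b"
  from adj consider
      (inner) s where "s \<in> {2..k}" "q = p[0 := p ! (s - 1), s - 1 := p ! 0]"
    | (outer) "q = p[0 := p ! k, k := p ! 0]"
    | (fresh) x where "x \<in> {1..Suc n} - set p" "q = p[0 := x]"
    unfolding star_adjacent_def using k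
    by (metis atLeastAtMost_iff diff_Suc_1 le_Suc_eq)
  then show ?thesis
  proof cases
    case inner
    have q: "q = u[0 := u ! (s - 1), s - 1 := u ! 0] @ [b]"
      using inner u k by (auto simp: nth_append list_update_append)
    have "absorb_last (Suc n) q
        = (map ?\<rho> u)[0 := map ?\<rho> u ! (s - 1), s - 1 := map ?\<rho> u ! 0]"
      using inner(1) u(2) k by (auto simp: q map_update)
    then have "star_adjacent n k (absorb_last (Suc n) p) (absorb_last (Suc n) q)"
      using inner(1) unfolding star_adjacent_def u(1) absorb_last_snoc by blast
    then show ?thesis by (simp add: u(1) q)
  next
    case fresh
    have q: "q = u[0 := x] @ [b]" using fresh u k by (auto simp: list_update_append)
    have "?\<rho> x \<in> {1..n} - set (map ?\<rho> u)"
      using transpose_last_into_smaller[of x n b] fresh(1) u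
      by (auto dest: injD[OF inj_transpose] simp: inj_image_mem_iff)
    moreover have "absorb_last (Suc n) q = (map ?\<rho> u)[0 := ?\<rho> x]"
      by (simp add: q map_update)
    ultimately have "star_adjacent n k (absorb_last (Suc n) p) (absorb_last (Suc n) q)"
      unfolding star_adjacent_def u(1) absorb_last_snoc by blast
    then show ?thesis by (simp add: u(1) q)
  next
    case outer
    have q: "q = (b # v) @ [a]"
      using outer u(1,2) v k by (auto simp: nth_append list_update_append)
    have p': "p = (a # v) @ [b]" using u(1) v by simp
    note absorbed = absorb_last_snoc[of "Suc n" "a # v" b, folded p']
      absorb_last_snoc[of "Suc n" "b # v" a, folded q]
    have last: "last p = b" "last q = a" by (simp_all add: p' q)
    show ?thesis
    proof (cases "a = Suc n \<or> b = Suc n")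
      case True
      then have "absorb_last (Suc n) p = absorb_last (Suc n) q"
        using ab by (auto simp: absorbed transpose_def intro!: map_cong)
      then show ?thesis using True ab by (auto simp: last)
    next
      case False
      then have heads: "?\<rho> a = a" "transpose (Suc n) a b = b"
        using ab by (auto simp: transpose_def)
      show ?thesis
      proof (cases "Suc n \<in> set v")
        case True
        then obtain j where j: "j < length v" "v ! j = Suc n"
          by (auto simp: in_set_conv_nth)
        have only: "v ! i = Suc n \<longleftrightarrow> i = j" if "i < length v" for i
          using j that u(3) v nth_eq_iff_index_eq[of v i j] by auto
        have "map (transpose (Suc n) a) v = (map ?\<rho> v)[j := a]"
        proof (rule nth_equalityI)
          fix i assume "i < length (map (transpose (Suc n) a) v)"
          then have i: "i < length v" by simp
          then have "v ! i \<noteq> a" "v ! i \<noteq> b" using ab by auto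
          then show "map (transpose (Suc n) a) v ! i = (map ?\<rho> v)[j := a] ! i"
            using i j only[OF i] by (auto simp: nth_list_update transpose_def)
        qed simp
        \<comment> \<open>Tail index \<open>j\<close> is index \<open>j + 1\<close> of the word, hence position \<open>s = j + 2\<close> counted from 1.\<close>
        then have "absorb_last (Suc n) q =
            (absorb_last (Suc n) p)[0 := absorb_last (Suc n) p ! (Suc (Suc j) - 1),
              Suc (Suc j) - 1 := absorb_last (Suc n) p ! 0]"
          using j heads by (simp add: absorbed)
        moreover have "Suc (Suc j) \<in> {2..k}" using j u(2) v by auto
        ultimately have "star_adjacent n k (absorb_last (Suc n) p) (absorb_last (Suc n) q)"
          unfolding star_adjacent_def by blast
        then show ?thesis using \<open>\<not> (a = Suc n \<or> b = Suc n)\<close> by (simp add: last)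
      next
        case noN: False
        have "transpose (Suc n) c x = x" if "x \<in> set v" "c = a \<or> c = b" for c x
          using that ab noN by (auto simp: transpose_def)
        then have "map ?\<rho> v = v" "map (transpose (Suc n) a) v = v"
          by (auto intro!: map_idI)
        then have "absorb_last (Suc n) p = a # v" "absorb_last (Suc n) q = (a # v)[0 := b]"
          using heads by (simp_all add: absorbed)
        moreover have "b \<in> {1..n} - set (a # v)" using u(5) False ab by auto
        ultimately have "star_adjacent n k (absorb_last (Suc n) p) (absorb_last (Suc n) q)"
          unfolding star_adjacent_def by metis
        then show ?thesis using False by (simp add: last)
      qed
    qed
  qed
qed

lemma star_graph_colouring_exists:
  assumes "1 \<le> k" "1 \<le> m"
  shows "\<exists>f. (\<forall>p \<in> k_permutations (m + k) k. f p \<le> m) \<and>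
    (\<forall>p \<in> k_permutations (m + k) k. \<forall>q. star_adjacent (m + k) k p q \<longrightarrow> f p \<noteq> (f q :: nat))"
  using assms(1)
proof (induction k rule: dec_induct)
  case base
  let ?f = "\<lambda>p. hd p - 1 :: nat"
  have "?f p \<le> m \<and> (\<forall>q. star_adjacent (m + 1) 1 p q \<longrightarrow> ?f p \<noteq> ?f q)"
    if "p \<in> k_permutations (m + 1) 1" for p
    using that by (auto simp: k_permutations_def star_adjacent_def length_Suc_conv)
  then show ?case by (intro exI[of _ ?f]) blast
next
  case (step k)
  then obtain f where range: "\<And>p. p \<in> k_permutations (m + k) k \<Longrightarrow> f p \<le> m"
    and proper: "\<And>p q. p \<in> k_permutations (m + k) k \<Longrightarrow> star_adjacent (m + k) k p q \<Longrightarrow>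
      f p \<noteq> (f q :: nat)"
    by metis
  let ?N = "Suc (m + k)"
  \<comment> \<open>The cyclic shift of the colours; it moves every colour because \<open>m \<ge> 1\<close>.\<close>
  let ?rot = "\<lambda>c. if c = m then 0 else Suc c"
  let ?g = "\<lambda>p. (if last p = ?N then ?rot else id) (f (absorb_last ?N p))"
  have g_range: "?g p \<le> m" if "p \<in> k_permutations ?N (Suc k)" for p
    using range[OF absorb_last_in_k_permutations[OF that]] by auto
  have g_proper: "?g p \<noteq> ?g q"
    if p: "p \<in> k_permutations ?N (Suc k)" and adj: "star_adjacent ?N (Suc k) p q" for p q
    using absorb_last_adjacent[OF p step.hyps(1) adj]
  proof (elim disjE conjE)
    assume same: "(last p = ?N) = (last q = ?N)"
      and adj': "star_adjacent (m + k) k (absorb_last ?N p) (absorb_last ?N q)"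
    have "f (absorb_last ?N p) \<noteq> f (absorb_last ?N q)"
      using proper[OF absorb_last_in_k_permutations[OF p] adj'] .
    then show ?thesis using same by auto
  next
    assume "(last p = ?N) \<noteq> (last q = ?N)" "absorb_last ?N p = absorb_last ?N q"
    then show ?thesis using assms(2) by auto
  qed
  show ?case using g_range g_proper by (intro exI[of _ ?g]) auto
qed

text \<open>The clique consists of the words whose symbols after the first are the $k - 1$ largest ones in
  increasing order.\<close>

lemma star_graph_colours_ge:
  assumes k: "1 \<le> k" "k \<le> n" and f: "proper_colouring (star_graph n k) c f"
  shows "n - k + 1 \<le> c"
proof -
  define w where "w x = x # [n - k + 2..<Suc n]" for x
  let ?X = "{1..n - k + 1}"
  have w: "w x \<in> k_permutations n k" if "x \<in> ?X" for x
    using that k by (auto simp: w_def k_permutations_def)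
  have adj: "star_adjacent n k (w x) (w y)" if "x \<in> ?X" "y \<in> ?X" "x \<noteq> y" for x y
    using that k unfolding star_adjacent_def w_def by (intro disjI2 bexI[of _ y]) auto
  have "inj_on (\<lambda>x. f (w x)) ?X"
  proof (rule inj_onI, rule ccontr)
    fix x y assume xy: "x \<in> ?X" "y \<in> ?X" "f (w x) = f (w y)" "x \<noteq> y"
    then have "(w x, w y) \<in> parcs (star_graph n k)"
      using w adj by (simp add: star_graph_def)
    then show False using f xy(3) by (auto simp: proper_colouring_def)
  qed
  moreover have "(\<lambda>x. f (w x)) ` ?X \<subseteq> {1..c}"
    using f w by (auto simp: proper_colouring_def star_graph_def)
  ultimately have "card ?X \<le> card {1..c}" by (intro card_inj_on_le) auto
  then show ?thesis by simp
qed

theorem corollary4p1: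
  fixes n k :: nat
  assumes "1 \<le> n" and "1 \<le> k" and "k \<le> n - 1"
  shows "chromatic_number (star_graph n k) = n - k + 1"
  unfolding chromatic_number_def
proof (rule Least_equality)
  have "1 \<le> n - k" "n - k + k = n" using assms by auto
  then obtain f where f: "\<forall>p \<in> k_permutations n k. f p \<le> n - k"
    "\<forall>p \<in> k_permutations n k. \<forall>q. star_adjacent n k p q \<longrightarrow> f p \<noteq> (f q :: nat)"
    using star_graph_colouring_exists[OF assms(2), of "n - k"] by auto
  then have "proper_colouring (star_graph n k) (n - k + 1) (\<lambda>p. Suc (f p))"
    by (auto simp: proper_colouring_def star_graph_def)
  then show "\<exists>f. proper_colouring (star_graph n k) (n - k + 1) f" by blast
next
  fix c assume "\<exists>f. proper_colouring (star_graph n k) c f"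
  then show "n - k + 1 \<le> c" using star_graph_colours_ge[OF assms(2)] assms(3) by auto
qed

end
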